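(* Let $G_1=(V_1,E_1)$ be an $n_1$-vertex graph which is $d_1$-regular and let $G_2=(V_2,E_2)$ be a $d_1$-vertex graph which is $d_2$-regular. Then for every set $X$ and every kernel $K:X\times X\to[0,\infty)$ (and for every choice of labels used to define the zigzag product), $$\gamma_+\left(G_1\circ_{\mathrm z} G_2,K\right)\le \gamma_+(G_1,K)\cdot \gamma_+(G_2,K)^2,$$ where $G_1\circ_{\mathrm z}G_2$ denotes the zigzag product.
   Context: Graphs are finite and undirected; self loops and multiple edges are allowed, and each self loop contributes $1$ to the degree of its vertex. The normalized adjacency matrix $A_G$ of a $d$-regular graph $G=(V,E)$ has $(u,v)$ entry equal to the number of edges joining $u$ and $v$, divided by $d$. A kernel on a set $X$ is a symmetric function $K:X\times X\to[0,\infty)$. For an $n\times n$ symmetric stochastic matrix $A=(a_{ij})$, $\gamma_+(A,K)\in[0,\infty]$ is the infimum over all $\gamma_+\ge 0$ such that for all $x_1,\dots,x_n,y_1,\dots,y_n\in X$, $$\frac1{n^2}\sum_{i=1}^n\sum_{j=1}^n K(x_i,y_j)\le\frac{\gamma_+}{n}\sum_{i=1}^n\sum_{j=1}^n a_{ij}K(x_i,y_j)$$ (the infimum of the empty set is $\infty$). For a regular graph $G$, $\gamma_+(G,K)=\gamma_+(A_G,K)$. Zigzag product: let $G_1=(V_1,E_1)$ be $d_1$-regular on $n_1$ vertices and $G_2=(V_2,E_2)$ be $d_2$-regular with $|V_2|=d_1$. Fix for every $u\in V_1$ a bijection $\pi_u:\{e\in E_1: u\in e\}\to V_2$, and for every $a\in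 V_2$ a bijection $\kappa_a$ from $[d_2]=\{1,\dots,d_2\}$ onto the multiset of vertices adjacent to $a$ in $G_2$. The zigzag product $G_1\circ_{\mathrm z}G_2$ has vertex set $V_1\times V_2$, and $(u,a),(v,b)$ are joined by an edge if and only if there are an edge $e\in E_1$ joining $u$ and $v$ and $i,j\in[d_2]$ with $a=\kappa_{\pi_u(e)}(i)$ and $b=\kappa_{\pi_v(e)}(j)$. Edges are counted with multiplicity: the number of edges joining $(u,a)$ and $(v,b)$ is $\sum_{e} m_2(\pi_u(e),a)\,m_2(\pi_v(e),b)$, the sum being over edges $e\in E_1$ joining $u$ and $v$, where $m_2(c,a)$ is the number of edges of $G_2$ joining $c$ and $a$. Thus $G_1\circ_{\mathrm z}G_2$ has $n_1d_1$ vertices and is $d_2^2$-regular. *)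

theory Defs
  imports Complex_Main "HOL-Library.FuncSet" "HOL-Library.Multiset"
    "HOL-Library.Extended_Nonnegative_Real"
begin

section \<open>Multigraphs\<close>

text \<open>
  Edges are abstract objects, so that parallel edges are distinguished; \<open>ends e\<close> is the set
  of endpoints of \<open>e\<close>, a singleton precisely for a self loop.
\<close>

record ('v, 'e) mgraph =
  verts :: "'v set"
  edges :: "'e set"
  ends :: "'e \<Rightarrow> 'v set"

definition multigraph :: "('v, 'e) mgraph \<Rightarrow> bool" where
  "multigraph G \<longleftrightarrow> finite (verts G) \<and> finite (edges G) \<and>
     (\<forall>e\<in>edges G. \<exists>u\<in>verts G. \<exists>v\<in>verts G. ends G e = {u, v})"

definition incident :: "('v, 'e) mgraph \<Rightarrow> 'v \<Rightarrow> 'e set" where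
  "incident G u = {e \<in> edges G. u \<in> ends G e}"

definition joining :: "('v, 'e) mgraph \<Rightarrow> 'v \<Rightarrow> 'v \<Rightarrow> 'e set" where
  "joining G u v = {e \<in> edges G. ends G e = {u, v}}"

text \<open>A self loop contributes 1 to the degree of its vertex.\<close>

definition regular :: "('v, 'e) mgraph \<Rightarrow> nat \<Rightarrow> bool" where
  "regular G d \<longleftrightarrow> multigraph G \<and> (\<forall>u\<in>verts G. card (incident G u) = d)"

definition neighbours :: "('v, 'e) mgraph \<Rightarrow> 'v \<Rightarrow> 'v multiset" where
  "neighbours G a = (\<Sum>b\<in>verts G. replicate_mset (card (joining G a b)) b)"

definition normalized_adjacency :: "('v, 'e) mgraph \<Rightarrow> nat \<Rightarrow> 'v \<Rightarrow> 'v \<Rightarrow> real" where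
  "normalized_adjacency G d u v = real (card (joining G u v)) / real d"


section \<open>Kernels and the Poincare constant\<close>

definition kernel_on :: "'x set \<Rightarrow> ('x \<Rightarrow> 'x \<Rightarrow> real) \<Rightarrow> bool" where
  "kernel_on X K \<longleftrightarrow> (\<forall>x\<in>X. \<forall>y\<in>X. 0 \<le> K x y \<and> K x y = K y x)"

text \<open>
  Matrices are indexed by a finite set \<open>I\<close>, so that \<open>n = card I\<close>. The infimum is taken in
  \<open>[0, \<infinity>]\<close>; in particular the infimum of the empty set is \<open>\<infinity>\<close>.
\<close>

definition gamma_plus ::
    "'i set \<Rightarrow> ('i \<Rightarrow> 'i \<Rightarrow> real) \<Rightarrow> 'x set \<Rightarrow> ('x \<Rightarrow> 'x \<Rightarrow> real) \<Rightarrow> ennreal" where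
  "gamma_plus I A X K = Inf {ennreal g | g. 0 \<le> g \<and>
     (\<forall>x \<in> I \<rightarrow> X. \<forall>y \<in> I \<rightarrow> X.
        1 / real (card I) ^ 2 * (\<Sum>i\<in>I. \<Sum>j\<in>I. K (x i) (y j))
          \<le> g / real (card I) * (\<Sum>i\<in>I. \<Sum>j\<in>I. A i j * K (x i) (y j)))}"

definition graph_gamma_plus ::
    "('v, 'e) mgraph \<Rightarrow> nat \<Rightarrow> 'x set \<Rightarrow> ('x \<Rightarrow> 'x \<Rightarrow> real) \<Rightarrow> ennreal" where
  "graph_gamma_plus G d X K = gamma_plus (verts G) (normalized_adjacency G d) X K"


section \<open>The zigzag product\<close>

definition zigzag_labels ::
    "('v, 'e) mgraph \<Rightarrow> ('w, 'f) mgraph \<Rightarrow> nat \<Rightarrow>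
     ('v \<Rightarrow> 'e \<Rightarrow> 'w) \<Rightarrow> ('w \<Rightarrow> nat \<Rightarrow> 'w) \<Rightarrow> bool" where
  "zigzag_labels G1 G2 d2 \<pi> \<kappa> \<longleftrightarrow>
     (\<forall>u\<in>verts G1. bij_betw (\<pi> u) (incident G1 u) (verts G2)) \<and>
     (\<forall>a\<in>verts G2. image_mset (\<kappa> a) (mset_set {1..d2}) = neighbours G2 a)"

fun zigzag_steps ::
    "('v, 'e) mgraph \<Rightarrow> nat \<Rightarrow> ('v \<Rightarrow> 'e \<Rightarrow> 'w) \<Rightarrow> ('w \<Rightarrow> nat \<Rightarrow> 'w) \<Rightarrow>
     'v \<times> 'w \<Rightarrow> 'v \<times> 'w \<Rightarrow> ('e \<times> nat \<times> nat) set" where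
  "zigzag_steps G1 d2 \<pi> \<kappa> (u, a) (v, b) =
     {(e, i, j). e \<in> joining G1 u v \<and> i \<in> {1..d2} \<and> j \<in> {1..d2} \<and>
        a = \<kappa> (\<pi> u e) i \<and> b = \<kappa> (\<pi> v e) j}"

text \<open>
  Each triple \<open>(e, i, j)\<close> leading from \<open>p\<close> to \<open>q\<close> stands for one edge joining them; reversing
  turns it into \<open>(e, j, i)\<close>, leading from \<open>q\<close> to \<open>p\<close>. To have each undirected edge once,
  the edges joining \<open>p\<close> and \<open>q\<close> are numbered by \<open>k < card (zigzag_steps \<dots> p q)\<close>, which is
  symmetric in \<open>p\<close> and \<open>q\<close>. At \<open>p = q\<close> the triples \<open>(e, i, j)\<close> and
  \<open>(e, j, i)\<close> count as different self loops when \<open>i \<noteq> j\<close>.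
\<close>

definition zigzag ::
    "('v, 'e) mgraph \<Rightarrow> ('w, 'f) mgraph \<Rightarrow> nat \<Rightarrow>
     ('v \<Rightarrow> 'e \<Rightarrow> 'w) \<Rightarrow> ('w \<Rightarrow> nat \<Rightarrow> 'w) \<Rightarrow>
     ('v \<times> 'w, ('v \<times> 'w) set \<times> nat) mgraph" where
  "zigzag G1 G2 d2 \<pi> \<kappa> =
     \<lparr> verts = verts G1 \<times> verts G2,
       edges = {({p, q}, k) | p q k. p \<in> verts G1 \<times> verts G2 \<and> q \<in> verts G1 \<times> verts G2 \<and>
                  k < card (zigzag_steps G1 d2 \<pi> \<kappa> p q)},
       ends = fst \<rparr>"


section \<open>Multiplicities and regularity of the zigzag product\<close>

lemma joining_commute: "joining G u v = joining G v u"
  by (simp add: joining_def insert_commute)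

lemma finite_joining: "multigraph G \<Longrightarrow> finite (joining G u v)"
  by (simp add: joining_def multigraph_def)

lemma joining_incident: "e \<in> joining G u v \<Longrightarrow> e \<in> incident G u \<and> e \<in> incident G v"
  by (auto simp: joining_def incident_def)

lemma incident_eq_UN:
  assumes "multigraph G"
  shows "incident G u = (\<Union>v\<in>verts G. joining G u v)"
proof
  show "incident G u \<subseteq> (\<Union>v\<in>verts G. joining G u v)"
  proof
    fix e assume e: "e \<in> incident G u"
    then obtain x y where "x \<in> verts G" "y \<in> verts G" "ends G e = {x, y}"
      using assms by (auto simp: multigraph_def incident_def)
    with e show "e \<in> (\<Union>v\<in>verts G. joining G u v)"
      by (auto simp: joining_def incident_def insert_commute)
  qed
qed (auto simp: joining_def incident_def)

lemma sum_incident: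
  fixes f :: "'e \<Rightarrow> nat"
  assumes "multigraph G"
  shows "(\<Sum>v\<in>verts G. \<Sum>e\<in>joining G u v. f e) = (\<Sum>e\<in>incident G u. f e)"
  unfolding incident_eq_UN[OF assms]
  by (rule sum.UNION_disjoint[symmetric])
     (use assms in \<open>auto simp: multigraph_def joining_def doubleton_eq_iff\<close>)

lemma card_incident:
  assumes "multigraph G"
  shows "card (incident G u) = (\<Sum>v\<in>verts G. card (joining G u v))"
  using sum_incident[OF assms, of "\<lambda>_. 1" u] by simp

lemma count_neighbours:
  assumes "multigraph G" "b \<in> verts G"
  shows "count (neighbours G a) b = card (joining G a b)"
  using assms by (simp add: neighbours_def count_sum multigraph_def if_distrib cong: if_cong)

lemma card_labels:
  assumes "multigraph G2" "zigzag_labels G1 G2 d2 \<pi> \<kappa>" "c \<in> verts G2" "a \<in> verts G2"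
  shows "card {i \<in> {1..d2}. a = \<kappa> c i} = card (joining G2 c a)"
proof -
  have "card {i \<in> {1..d2}. a = \<kappa> c i} = count (image_mset (\<kappa> c) (mset_set {1..d2})) a"
    by (simp add: count_image_mset vimage_def Int_def conj_commute eq_commute[of a])
  also have "\<dots> = card (joining G2 c a)"
    using assms count_neighbours by (metis zigzag_labels_def)
  finally show ?thesis .
qed

lemma zigzag_steps_eq_Sigma:
  "zigzag_steps G1 d2 \<pi> \<kappa> (u, a) (v, b) =
     (SIGMA e : joining G1 u v. {i \<in> {1..d2}. a = \<kappa> (\<pi> u e) i} \<times> {j \<in> {1..d2}. b = \<kappa> (\<pi> v e) j})"
  by auto

lemma card_zigzag_steps_commute:
  "card (zigzag_steps G1 d2 \<pi> \<kappa> p q) = card (zigzag_steps G1 d2 \<pi> \<kappa> q p)"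
proof -
  obtain u a v b where [simp]: "p = (u, a)" "q = (v, b)" by (metis surj_pair)
  have "bij_betw (\<lambda>(e, i, j). (e, j, i)) (zigzag_steps G1 d2 \<pi> \<kappa> p q) (zigzag_steps G1 d2 \<pi> \<kappa> q p)"
    by (rule bij_betw_byWitness[where f' = "\<lambda>(e, i, j). (e, j, i)"])
       (auto simp: joining_commute[of G1 u v])
  then show ?thesis by (rule bij_betw_same_card)
qed

lemma card_joining_zigzag_steps:
  assumes "p \<in> verts G1 \<times> verts G2" "q \<in> verts G1 \<times> verts G2"
  shows "card (joining (zigzag G1 G2 d2 \<pi> \<kappa>) p q) = card (zigzag_steps G1 d2 \<pi> \<kappa> p q)"
proof -
  have "k < card (zigzag_steps G1 d2 \<pi> \<kappa> p q)"
    if "{p', q'} = {p, q}" "k < card (zigzag_steps G1 d2 \<pi> \<kappa> p' q')" for p' q' k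
    using that card_zigzag_steps_commute[of G1 d2 \<pi> \<kappa> p q] by (metis doubleton_eq_iff)
  then have "joining (zigzag G1 G2 d2 \<pi> \<kappa>) p q =
      Pair {p, q} ` {..<card (zigzag_steps G1 d2 \<pi> \<kappa> p q)}"
    using assms unfolding joining_def zigzag_def image_def by fastforce
  then show ?thesis by (simp add: card_image inj_on_def)
qed

lemma card_joining_zigzag:
  assumes "multigraph G1" "multigraph G2" "zigzag_labels G1 G2 d2 \<pi> \<kappa>"
    and "u \<in> verts G1" "v \<in> verts G1" "a \<in> verts G2" "b \<in> verts G2"
  shows "card (joining (zigzag G1 G2 d2 \<pi> \<kappa>) (u, a) (v, b)) =
    (\<Sum>e\<in>joining G1 u v. card (joining G2 (\<pi> u e) a) * card (joining G2 (\<pi> v e) b))"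
proof -
  have pi: "\<pi> u e \<in> verts G2" "\<pi> v e \<in> verts G2" if "e \<in> joining G1 u v" for e
    using joining_incident[OF that] assms by (auto simp: zigzag_labels_def dest: bij_betwE)
  have "card (joining (zigzag G1 G2 d2 \<pi> \<kappa>) (u, a) (v, b)) =
      (\<Sum>e\<in>joining G1 u v. card ({i \<in> {1..d2}. a = \<kappa> (\<pi> u e) i} \<times> {j \<in> {1..d2}. b = \<kappa> (\<pi> v e) j}))"
    using assms finite_joining[OF assms(1), of u v]
    by (simp add: card_joining_zigzag_steps zigzag_steps_eq_Sigma del: zigzag_steps.simps)
  also have "\<dots> = (\<Sum>e\<in>joining G1 u v. card (joining G2 (\<pi> u e) a) * card (joining G2 (\<pi> v e) b))"
    using pi assms card_labels[OF assms(2,3)]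
    by (intro sum.cong) (simp_all only: card_cartesian_product)
  finally show ?thesis .
qed

lemma multigraph_zigzag:
  assumes "multigraph G1" "multigraph G2"
  shows "multigraph (zigzag G1 G2 d2 \<pi> \<kappa>)"
proof -
  let ?V = "verts G1 \<times> verts G2"
  have fin: "finite ?V" using assms by (simp add: multigraph_def)
  have "edges (zigzag G1 G2 d2 \<pi> \<kappa>) =
      (\<Union>p\<in>?V. \<Union>q\<in>?V. Pair {p, q} ` {..<card (zigzag_steps G1 d2 \<pi> \<kappa> p q)})"
    unfolding zigzag_def by fastforce
  also have "finite \<dots>" using fin by (intro finite_UN_I) auto
  finally show ?thesis
    using fin unfolding multigraph_def by (auto simp: zigzag_def; blast)
qed

lemma regular_zigzag:
  assumes "regular G1 d1" "regular G2 d2" "zigzag_labels G1 G2 d2 \<pi> \<kappa>"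
  shows "regular (zigzag G1 G2 d2 \<pi> \<kappa>) (d2\<^sup>2)"
proof -
  have G: "multigraph G1" "multigraph G2" using assms by (auto simp: regular_def)
  have deg: "(\<Sum>b\<in>verts G2. card (joining G2 c b)) = d2" if "c \<in> verts G2" for c
    using assms(2) that card_incident[OF G(2)] by (auto simp: regular_def)
  have "card (incident (zigzag G1 G2 d2 \<pi> \<kappa>) (u, a)) = d2\<^sup>2"
    if ua: "u \<in> verts G1" "a \<in> verts G2" for u a
  proof -
    have "card (incident (zigzag G1 G2 d2 \<pi> \<kappa>) (u, a)) =
        (\<Sum>(v, b)\<in>verts G1 \<times> verts G2. card (joining (zigzag G1 G2 d2 \<pi> \<kappa>) (u, a) (v, b)))"
      unfolding card_incident[OF multigraph_zigzag[OF G]] by (simp add: zigzag_def case_prod_beta)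
    also have "\<dots> = (\<Sum>v\<in>verts G1. \<Sum>b\<in>verts G2. \<Sum>e\<in>joining G1 u v.
        card (joining G2 (\<pi> u e) a) * card (joining G2 (\<pi> v e) b))"
      unfolding sum.cartesian_product[symmetric]
      by (intro sum.cong refl card_joining_zigzag[OF G assms(3)] ua)
    also have "\<dots> = (\<Sum>v\<in>verts G1. \<Sum>e\<in>joining G1 u v. card (joining G2 (\<pi> u e) a) * d2)"
    proof (rule sum.cong[OF refl])
      fix v assume v: "v \<in> verts G1"
      have pi: "\<pi> v e \<in> verts G2" if "e \<in> joining G1 u v" for e
        using joining_incident[OF that] assms(3) v by (auto simp: zigzag_labels_def dest: bij_betwE)
      show "(\<Sum>b\<in>verts G2. \<Sum>e\<in>joining G1 u v.
          card (joining G2 (\<pi> u e) a) * card (joining G2 (\<pi> v e) b)) =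
        (\<Sum>e\<in>joining G1 u v. card (joining G2 (\<pi> u e) a) * d2)"
        by (subst sum.swap) (simp add: sum_distrib_left[symmetric] deg pi)
    qed
    also have "\<dots> = (\<Sum>e\<in>incident G1 u. card (joining G2 (\<pi> u e) a) * d2)"
      by (rule sum_incident[OF G(1)])
    also have "\<dots> = (\<Sum>c\<in>verts G2. card (joining G2 c a) * d2)"
      using assms(3) ua by (intro sum.reindex_bij_betw) (auto simp: zigzag_labels_def)
    also have "\<dots> = d2\<^sup>2"
      using deg[OF ua(2)]
      by (simp add: sum_distrib_right[symmetric] joining_commute[of G2 _ a] power2_eq_square)
    finally show ?thesis .
  qed
  then show ?thesis
    using multigraph_zigzag[OF G] by (auto simp: regular_def zigzag_def)
qed

end

theory Submission
  imports Defs
begin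

text \<open>
  Write \<open>J u v\<close> for the edges of \<open>G1\<close> joining \<open>u\<close> and \<open>v\<close>. For points \<open>x (u, a)\<close> and \<open>y (v, b)\<close>
  one has to compare the sum of \<open>K (x (u, a)) (y (v, b))\<close> over all \<open>u, v, a, b\<close> with the same sum
  weighted by the adjacency matrix of the zigzag product. Let \<open>g1\<close> and \<open>g2\<close> be Poincare constants
  of \<open>G1\<close> and \<open>G2\<close>. The comparison takes three steps, one for each factor of \<open>g1 * g2 * g2\<close>.

  For fixed \<open>a\<close> and \<open>b\<close>, the inequality for \<open>G1\<close> restricts the sum to pairs \<open>u, v\<close> joined by an
  edge \<open>e\<close> (the zag). For fixed \<open>u\<close> and \<open>b\<close>, the pairs \<open>(v, e)\<close> with \<open>e \<in> J u v\<close> are numbered by the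
  vertices \<open>c = \<pi> u e\<close> of \<open>G2\<close>, so the sum over \<open>v, e, a\<close> runs over all pairs \<open>(a, c)\<close> of vertices
  of \<open>G2\<close>, and the inequality for \<open>G2\<close> inserts the weight of \<open>(a, \<pi> u e)\<close> (the first zig). What
  remains is to insert the weight of \<open>(b, \<pi> v e)\<close> by the same argument at \<open>v\<close>. Now the weight that
  is already there depends on \<open>a\<close> and \<open>e\<close>; but since \<open>\<kappa> c\<close> lists the neighbours of \<open>c\<close>, the weighted
  sum over \<open>a\<close> is an average over \<open>i\<close> of values at \<open>a = \<kappa> (\<pi> u e) i\<close>, and for fixed \<open>i\<close> and \<open>v\<close> the
  points \<open>x (u, \<kappa> (\<pi> u e) i)\<close> are again a family indexed by the edges at \<open>v\<close>. Both zigs are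
  instances of \<open>poincare_at_vertex\<close>, and \<open>poincare_zigzag\<close> assembles the three steps.

  The passage to infima is immediate when both are finite, because a finite infimum is attained
  (\<open>poincare_gamma_plus\<close>). As \<open>0 * \<infinity> = 0\<close> in \<open>[0, \<infinity>]\<close>, an infinite factor makes the right-hand
  side infinite only if the other factor is not \<open>0\<close>. But a factor is \<open>0\<close> only if \<open>K\<close> vanishes on \<open>X\<close>
  or its graph has no vertices (\<open>gamma_plus_eq_0D\<close>), and then the left-hand side is \<open>0\<close>.
\<close>

section \<open>Poincare inequalities and their best constant\<close>

text \<open>
  The inequality is cleared of denominators, so that an empty index set needs no exception: then
  both sides are \<open>0\<close>, as they are in the form with denominators.
\<close>

definition poincare ::
    "'i set \<Rightarrow> ('i \<Rightarrow> 'i \<Rightarrow> real) \<Rightarrow> 'x set \<Rightarrow> ('x \<Rightarrow> 'x \<Rightarrow> real) \<Rightarrow> real \<Rightarrow> bool" where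
  "poincare I A X K g \<longleftrightarrow> 0 \<le> g \<and> (\<forall>x \<in> I \<rightarrow> X. \<forall>y \<in> I \<rightarrow> X.
     (\<Sum>i\<in>I. \<Sum>j\<in>I. K (x i) (y j)) \<le> g * real (card I) * (\<Sum>i\<in>I. \<Sum>j\<in>I. A i j * K (x i) (y j)))"

lemma poincareD:
  assumes "poincare I A X K g" "x \<in> I \<rightarrow> X" "y \<in> I \<rightarrow> X"
  shows "(\<Sum>i\<in>I. \<Sum>j\<in>I. K (x i) (y j))
    \<le> g * real (card I) * (\<Sum>i\<in>I. \<Sum>j\<in>I. A i j * K (x i) (y j))"
  using assms by (auto simp: poincare_def)

lemma gamma_plus_eq_Inf_poincare:
  assumes "finite I"
  shows "gamma_plus I A X K = Inf {ennreal g | g. poincare I A X K g}"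
proof -
  have "(1 / real (card I) ^ 2 * S \<le> g / real (card I) * T) \<longleftrightarrow> (S \<le> g * real (card I) * T)"
    if "I \<noteq> {}" for S T g :: real
  proof -
    have "card I > 0" using assms that by (simp add: card_gt_0_iff)
    then show ?thesis by (simp add: divide_simps power2_eq_square mult_ac)
  qed
  then show ?thesis
    unfolding gamma_plus_def poincare_def by (cases "I = {}") auto
qed

lemma gamma_plus_le:
  assumes "finite I" "poincare I A X K g"
  shows "gamma_plus I A X K \<le> ennreal g"
  unfolding gamma_plus_eq_Inf_poincare[OF assms(1)] using assms(2) by (auto intro: Inf_lower)

text \<open>
  Each inequality is closed in the constant, and it survives an increase of the constant since
  its right-hand side is nonnegative. So a finite infimum is itself a valid constant.
\<close>

lemma poincare_gamma_plus:
  assumes fin: "finite I"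
    and A: "\<And>i j. i \<in> I \<Longrightarrow> j \<in> I \<Longrightarrow> 0 \<le> A i j" and K: "kernel_on X K"
    and "gamma_plus I A X K \<noteq> \<infinity>"
  shows "\<exists>g. gamma_plus I A X K = ennreal g \<and> poincare I A X K g"
proof -
  obtain g where g: "0 \<le> g" "gamma_plus I A X K = ennreal g"
    using assms(4) by (cases "gamma_plus I A X K") auto
  have "(\<Sum>i\<in>I. \<Sum>j\<in>I. K (x i) (y j)) \<le> g * real (card I) * (\<Sum>i\<in>I. \<Sum>j\<in>I. A i j * K (x i) (y j))"
      (is "?S \<le> g * ?n * ?T") if xy: "x \<in> I \<rightarrow> X" "y \<in> I \<rightarrow> X" for x y
  proof (rule field_le_epsilon)
    fix \<epsilon> :: real assume "0 < \<epsilon>"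
    have T: "0 \<le> ?n * ?T"
      using A K xy by (intro mult_nonneg_nonneg sum_nonneg) (auto simp: kernel_on_def Pi_iff)
    \<comment> \<open>the increment of the constant that costs at most \<open>\<epsilon>\<close>; the \<open>1\<close> guards against \<open>?n * ?T = 0\<close>\<close>
    define \<delta> where "\<delta> = \<epsilon> / (?n * ?T + 1)"
    have \<delta>: "0 < \<delta>" "\<delta> * (?n * ?T) \<le> \<epsilon>"
      using T \<open>0 < \<epsilon>\<close> by (auto simp: \<delta>_def field_simps)
    have "Inf {ennreal g | g. poincare I A X K g} < ennreal (g + \<delta>)"
      using g \<delta>(1) by (simp add: gamma_plus_eq_Inf_poincare[OF fin, symmetric] ennreal_less_iff)
    then obtain h where h: "poincare I A X K h" "ennreal h < ennreal (g + \<delta>)"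
      by (auto simp: Inf_less_iff)
    then have "h \<le> g + \<delta>"
      by (simp add: ennreal_less_iff poincare_def)
    have "?S \<le> h * (?n * ?T)"
      using poincareD[OF h(1) xy] by (simp add: mult.assoc)
    also have "\<dots> \<le> (g + \<delta>) * (?n * ?T)"
      using \<open>h \<le> g + \<delta>\<close> T by (rule mult_right_mono)
    also have "\<dots> \<le> g * ?n * ?T + \<epsilon>"
      using \<delta>(2) by (simp add: algebra_simps)
    finally show "?S \<le> g * ?n * ?T + \<epsilon>" .
  qed
  then have "poincare I A X K g"
    using g(1) by (simp add: poincare_def)
  with g(2) show ?thesis by blast
qed

text \<open>The constant \<open>0\<close> makes the sums of \<open>K\<close> over constant families vanish.\<close>

lemma gamma_plus_eq_0D:
  assumes "finite I" "I \<noteq> {}"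
    and "\<And>i j. i \<in> I \<Longrightarrow> j \<in> I \<Longrightarrow> 0 \<le> A i j" and K: "kernel_on X K"
    and zero: "gamma_plus I A X K = 0" and xy: "x \<in> X" "y \<in> X"
  shows "K x y = 0"
proof -
  have "gamma_plus I A X K \<noteq> \<infinity>" using zero by simp
  from poincare_gamma_plus[OF assms(1,3) K this]
  obtain g where g: "gamma_plus I A X K = ennreal g" "poincare I A X K g" by blast
  then have "g = 0"
    using zero by (simp add: poincare_def ennreal_eq_0_iff)
  with poincareD[OF g(2), of "\<lambda>_. x" "\<lambda>_. y"] xy
  have "real (card I) * (real (card I) * K x y) \<le> 0" by simp
  moreover have "card I > 0" using assms by (simp add: card_gt_0_iff)
  ultimately have "K x y \<le> 0" by (simp add: mult_le_0_iff)
  with K xy show ?thesis by (auto simp: kernel_on_def intro: antisym)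
qed


section \<open>Labelled edges\<close>

lemma normalized_adjacency_nonneg: "0 \<le> normalized_adjacency G d u v"
  by (simp add: normalized_adjacency_def)

text \<open>
  The pairs \<open>(v, e)\<close> of a vertex and an edge that joins it to \<open>u\<close> correspond to the edges at \<open>u\<close>, and
  through \<open>\<pi>\<close> to the labels. In the zigzag product the labels are the vertices of the second graph,
  and this is how a family indexed by edges of the first graph can enter its Poincare inequality.
\<close>

lemma edges_by_label:
  assumes G: "multigraph G" and \<pi>: "bij_betw \<pi> (incident G u) W"
  obtains nb ed where
    "\<And>c. c \<in> W \<Longrightarrow> nb c \<in> verts G \<and> ed c \<in> joining G u (nb c) \<and> \<pi> (ed c) = c"
    "\<And>F :: 'v \<Rightarrow> 'e \<Rightarrow> real.
       (\<Sum>v\<in>verts G. \<Sum>e\<in>joining G u v. F v e) = (\<Sum>c\<in>W. F (nb c) (ed c))"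
proof -
  have "\<exists>v e. v \<in> verts G \<and> e \<in> joining G u v \<and> \<pi> e = c" if "c \<in> W" for c
    using \<pi> that unfolding incident_eq_UN[OF G] bij_betw_def by blast
  then obtain nb ed where
    ne: "\<And>c. c \<in> W \<Longrightarrow> nb c \<in> verts G \<and> ed c \<in> joining G u (nb c) \<and> \<pi> (ed c) = c"
    by metis
  have "(\<Sum>v\<in>verts G. \<Sum>e\<in>joining G u v. F v e) = (\<Sum>c\<in>W. F (nb c) (ed c))"
    for F :: "'v \<Rightarrow> 'e \<Rightarrow> real"
  proof -
    have "(\<Sum>v\<in>verts G. \<Sum>e\<in>joining G u v. F v e)
        = (\<Sum>(v, e)\<in>Sigma (verts G) (joining G u). F v e)"
      using G by (intro sum.Sigma) (auto simp: multigraph_def joining_def)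
    also have "\<dots> = (\<Sum>c\<in>W. F (nb c) (ed c))"
    proof (rule sum.reindex_bij_witness[where i = "\<lambda>c. (nb c, ed c)" and j = "\<lambda>(v, e). \<pi> e"])
      fix p assume "p \<in> Sigma (verts G) (joining G u)"
      then obtain v e where p: "p = (v, e)" "v \<in> verts G" "e \<in> joining G u v" by auto
      have e: "e \<in> incident G u" using joining_incident[OF p(3)] by simp
      then have W: "\<pi> e \<in> W" using \<pi> by (auto dest: bij_betwE)
      have "ed (\<pi> e) \<in> incident G u" using ne[OF W] joining_incident by metis
      then have ed: "ed (\<pi> e) = e"
        using e ne[OF W] \<pi> by (auto simp: bij_betw_def dest: inj_onD)
      moreover have "nb (\<pi> e) = v"
        using ne[OF W] p(3) ed by (auto simp: joining_def doubleton_eq_iff)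
      ultimately show "(\<lambda>c. (nb c, ed c)) (case p of (v, e) \<Rightarrow> \<pi> e) = p"
        "(case p of (v, e) \<Rightarrow> \<pi> e) \<in> W"
        "F (nb (case p of (v, e) \<Rightarrow> \<pi> e)) (ed (case p of (v, e) \<Rightarrow> \<pi> e)) = (case p of (v, e) \<Rightarrow> F v e)"
        using p W by simp_all
    qed (use ne in auto)
    finally show ?thesis .
  qed
  with ne that show ?thesis by blast
qed

lemma label_in_verts:
  assumes "multigraph G2" "zigzag_labels G1 G2 d2 \<pi> \<kappa>" "c \<in> verts G2" and i: "i \<in> {1..d2}"
  shows "\<kappa> c i \<in> verts G2"
proof -
  have "\<kappa> c i \<in># image_mset (\<kappa> c) (mset_set {1..d2})" using i by simp
  also have "image_mset (\<kappa> c) (mset_set {1..d2}) = neighbours G2 c"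
    using assms by (simp add: zigzag_labels_def)
  finally show ?thesis
    using assms(1) by (auto simp: neighbours_def set_mset_sum multigraph_def split: if_splits)
qed

text \<open>
  Since \<open>\<kappa> c\<close> lists the neighbours of \<open>c\<close> with multiplicity, weighting by the adjacency matrix is
  averaging over labels. This turns a weight that varies with \<open>c\<close> into a uniform one.
\<close>

lemma sum_neighbours:
  fixes f :: "'w \<Rightarrow> real"
  assumes G2: "multigraph G2" and "zigzag_labels G1 G2 d2 \<pi> \<kappa>" and c: "c \<in> verts G2"
  shows "(\<Sum>a\<in>verts G2. normalized_adjacency G2 d2 a c * f a) = (\<Sum>i\<in>{1..d2}. f (\<kappa> c i)) / real d2"
proof -
  have "(\<Sum>i\<in>{1..d2}. f (\<kappa> c i))
      = (\<Sum>a\<in>verts G2. \<Sum>i\<in>{i \<in> {1..d2}. \<kappa> c i = a}. f (\<kappa> c i))"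
    using G2 label_in_verts[OF assms]
    by (intro sum.group[symmetric]) (auto simp: multigraph_def)
  also have "\<dots> = (\<Sum>a\<in>verts G2. \<Sum>i\<in>{i \<in> {1..d2}. a = \<kappa> c i}. f a)"
    by (intro sum.cong) auto
  also have "\<dots> = (\<Sum>a\<in>verts G2. real (card {i \<in> {1..d2}. a = \<kappa> c i}) * f a)"
    by (simp only: sum_constant)
  also have "\<dots> = (\<Sum>a\<in>verts G2. real (card (joining G2 c a)) * f a)"
    by (intro sum.cong refl) (simp only: card_labels[OF assms])
  finally show ?thesis
    by (simp add: normalized_adjacency_def joining_commute[of G2 _ c] sum_divide_distrib)
qed


section \<open>The Poincare inequality for the zigzag product\<close>

text \<open>
  This is the inequality for \<open>G2\<close>, applied for each \<open>i\<close> to the families \<open>f\<close> and \<open>g v e i\<close>, the second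
  being indexed by the vertices \<open>\<pi> u e\<close> of \<open>G2\<close> in place of the edges \<open>e\<close> at \<open>u\<close>. The index \<open>i\<close> lets one
  statement serve both zigs: it is a vertex of \<open>G2\<close> in one and a label of a neighbour in the other.
\<close>

lemma poincare_at_vertex:
  assumes G1: "multigraph G1" and lab: "zigzag_labels G1 G2 d2 \<pi> \<kappa>" and u: "u \<in> verts G1"
    and P: "poincare (verts G2) (normalized_adjacency G2 d2) X K g2"
    and f: "\<And>a. a \<in> verts G2 \<Longrightarrow> f a \<in> X"
    and g: "\<And>v e i. v \<in> verts G1 \<Longrightarrow> e \<in> joining G1 u v \<Longrightarrow> i \<in> I \<Longrightarrow> g v e i \<in> X"
  shows "(\<Sum>v\<in>verts G1. \<Sum>e\<in>joining G1 u v. \<Sum>i\<in>I. \<Sum>a\<in>verts G2. K (f a) (g v e i))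
    \<le> g2 * real (card (verts G2)) *
      (\<Sum>v\<in>verts G1. \<Sum>e\<in>joining G1 u v. \<Sum>i\<in>I. \<Sum>a\<in>verts G2.
         normalized_adjacency G2 d2 a (\<pi> u e) * K (f a) (g v e i))"
proof -
  let ?A = "normalized_adjacency G2 d2" and ?W = "verts G2"
  have \<pi>: "bij_betw (\<pi> u) (incident G1 u) ?W" using lab u by (simp add: zigzag_labels_def)
  obtain nb ed where
    ne: "\<And>c. c \<in> ?W \<Longrightarrow> nb c \<in> verts G1 \<and> ed c \<in> joining G1 u (nb c) \<and> \<pi> u (ed c) = c" and
    sum: "\<And>F :: _ \<Rightarrow> _ \<Rightarrow> real.
       (\<Sum>v\<in>verts G1. \<Sum>e\<in>joining G1 u v. F v e) = (\<Sum>c\<in>?W. F (nb c) (ed c))"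
    by (rule edges_by_label[OF G1 \<pi>], rule that)
  have "(\<Sum>v\<in>verts G1. \<Sum>e\<in>joining G1 u v. \<Sum>i\<in>I. \<Sum>a\<in>?W. K (f a) (g v e i))
      = (\<Sum>i\<in>I. \<Sum>a\<in>?W. \<Sum>c\<in>?W. K (f a) (g (nb c) (ed c) i))"
    unfolding sum by (subst sum.swap) (intro sum.cong refl sum.swap)
  also have "\<dots> \<le> (\<Sum>i\<in>I. g2 * real (card ?W) *
      (\<Sum>a\<in>?W. \<Sum>c\<in>?W. ?A a c * K (f a) (g (nb c) (ed c) i)))"
    using f g ne by (intro sum_mono poincareD[OF P]) auto
  also have "\<dots> = g2 * real (card ?W) *
      (\<Sum>c\<in>?W. \<Sum>i\<in>I. \<Sum>a\<in>?W. ?A a c * K (f a) (g (nb c) (ed c) i))"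
    unfolding sum_distrib_left[symmetric]
    by (subst (2) sum.swap) (intro arg_cong[where f = "(*) _"] sum.cong refl sum.swap)
  also have "(\<Sum>c\<in>?W. \<Sum>i\<in>I. \<Sum>a\<in>?W. ?A a c * K (f a) (g (nb c) (ed c) i))
      = (\<Sum>v\<in>verts G1. \<Sum>e\<in>joining G1 u v. \<Sum>i\<in>I. \<Sum>a\<in>?W. ?A a (\<pi> u e) * K (f a) (g v e i))"
    unfolding sum using ne by (intro sum.cong) auto
  finally show ?thesis .
qed

lemma normalized_adjacency_zigzag:
  assumes "multigraph G1" "multigraph G2" "zigzag_labels G1 G2 d2 \<pi> \<kappa>"
    and "u \<in> verts G1" "v \<in> verts G1" "a \<in> verts G2" "b \<in> verts G2"
  shows "normalized_adjacency (zigzag G1 G2 d2 \<pi> \<kappa>) (d2\<^sup>2) (u, a) (v, b) =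
    (\<Sum>e\<in>joining G1 u v. normalized_adjacency G2 d2 a (\<pi> u e) * normalized_adjacency G2 d2 b (\<pi> v e))"
  unfolding normalized_adjacency_def card_joining_zigzag[OF assms]
  by (simp add: sum_divide_distrib power2_eq_square joining_commute[of G2 a] joining_commute[of G2 b])

lemma poincare_zigzag:
  assumes G1: "multigraph G1" and G2: "multigraph G2" and d1: "card (verts G2) = d1"
    and lab: "zigzag_labels G1 G2 d2 \<pi> \<kappa>" and K: "kernel_on X K"
    and P1: "poincare (verts G1) (normalized_adjacency G1 d1) X K g1"
    and P2: "poincare (verts G2) (normalized_adjacency G2 d2) X K g2"
  shows "poincare (verts G1 \<times> verts G2) (normalized_adjacency (zigzag G1 G2 d2 \<pi> \<kappa>) (d2\<^sup>2)) X K
    (g1 * g2\<^sup>2)"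
proof -
  let ?V = "verts G1" and ?W = "verts G2" and ?J = "joining G1"
  let ?A = "normalized_adjacency G2 d2" and ?Z = "normalized_adjacency (zigzag G1 G2 d2 \<pi> \<kappa>) (d2\<^sup>2)"
  define n1 where "n1 = card ?V"
  have g: "0 \<le> g1" "0 \<le> g2" using P1 P2 by (auto simp: poincare_def)
  have \<pi>: "\<pi> u e \<in> ?W" if "e \<in> ?J u v" "u \<in> ?V" for u v e
    using joining_incident[OF that(1)] lab that(2) by (auto simp: zigzag_labels_def dest: bij_betwE)
  note \<kappa> = label_in_verts[OF G2 lab]
  note pull_out_W = sum.swap[of _ ?W ?V] sum.swap[of _ ?W "?J u v" for u v]
  have main: "(\<Sum>p\<in>?V \<times> ?W. \<Sum>q\<in>?V \<times> ?W. K (x p) (y q))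
      \<le> g1 * g2\<^sup>2 * real (card (?V \<times> ?W)) * (\<Sum>p\<in>?V \<times> ?W. \<Sum>q\<in>?V \<times> ?W. ?Z p q * K (x p) (y q))"
    if x: "x \<in> ?V \<times> ?W \<rightarrow> X" and y: "y \<in> ?V \<times> ?W \<rightarrow> X" for x y
  proof -
    define k where "k u v a b = K (x (u, a)) (y (v, b))" for u v a b
    \<comment> \<open>In the second zig, \<open>y\<close> is the fixed family and \<open>x\<close> the one that varies with the edge.\<close>
    have k_sym: "k u v a b = K (y (v, b)) (x (u, a))"
      if "u \<in> ?V" "v \<in> ?V" "a \<in> ?W" "b \<in> ?W" for u v a b
      using K x y that by (auto simp: k_def kernel_on_def Pi_iff)
    \<comment> \<open>The right-hand sides of the zag, the first zig and the second zig, up to constants.\<close>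
    define S0 where "S0 = (\<Sum>u\<in>?V. \<Sum>v\<in>?V. \<Sum>e\<in>?J u v. \<Sum>b\<in>?W. \<Sum>a\<in>?W. k u v a b)"
    define S1 where
      "S1 = (\<Sum>u\<in>?V. \<Sum>v\<in>?V. \<Sum>e\<in>?J u v. \<Sum>b\<in>?W. \<Sum>a\<in>?W. ?A a (\<pi> u e) * k u v a b)"
    define S2 where
      "S2 = (\<Sum>u\<in>?V. \<Sum>v\<in>?V. \<Sum>e\<in>?J u v. \<Sum>b\<in>?W. \<Sum>a\<in>?W. ?A a (\<pi> u e) * ?A b (\<pi> v e) * k u v a b)"
    have "(\<Sum>p\<in>?V \<times> ?W. \<Sum>q\<in>?V \<times> ?W. K (x p) (y q))
        = (\<Sum>u\<in>?V. \<Sum>a\<in>?W. \<Sum>v\<in>?V. \<Sum>b\<in>?W. k u v a b)"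
      by (simp add: sum.cartesian_product' k_def)
    also have "\<dots> = (\<Sum>a\<in>?W. \<Sum>b\<in>?W. \<Sum>u\<in>?V. \<Sum>v\<in>?V. k u v a b)"
      by (simp add: sum.swap[of _ ?W ?V])
    also have "\<dots> \<le> (\<Sum>a\<in>?W. \<Sum>b\<in>?W.
        g1 * real n1 * (\<Sum>u\<in>?V. \<Sum>v\<in>?V. normalized_adjacency G1 d1 u v * k u v a b))"
      unfolding k_def n1_def using x y by (intro sum_mono poincareD[OF P1]) auto
    also have "\<dots> = g1 * real n1 / real d1 *
        (\<Sum>a\<in>?W. \<Sum>b\<in>?W. \<Sum>u\<in>?V. \<Sum>v\<in>?V. \<Sum>e\<in>?J u v. k u v a b)"
      by (simp add: sum_distrib_left normalized_adjacency_def mult_ac)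
    also have "(\<Sum>a\<in>?W. \<Sum>b\<in>?W. \<Sum>u\<in>?V. \<Sum>v\<in>?V. \<Sum>e\<in>?J u v. k u v a b) = S0"
      unfolding S0_def by (simp only: pull_out_W) (rule sum.swap)
    finally have zag: "(\<Sum>p\<in>?V \<times> ?W. \<Sum>q\<in>?V \<times> ?W. K (x p) (y q)) \<le> g1 * real n1 / real d1 * S0" .
    have "S0 \<le> (\<Sum>u\<in>?V. g2 * real d1 *
        (\<Sum>v\<in>?V. \<Sum>e\<in>?J u v. \<Sum>b\<in>?W. \<Sum>a\<in>?W. ?A a (\<pi> u e) * k u v a b))"
      unfolding S0_def k_def d1[symmetric] using x y
      by (intro sum_mono poincare_at_vertex[OF G1 lab _ P2]) auto
    then have zig1: "S0 \<le> g2 * real d1 * S1"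
      by (simp add: S1_def sum_distrib_left)
    \<comment> \<open>This rewrites both sides of the second zig as sums seen from \<open>v\<close>: the left-hand side with
      \<open>h = 1\<close>, the right-hand side with \<open>h\<close> the weight of \<open>(b, \<pi> v e)\<close> that the zig inserts.\<close>
    have by_labels:
      "(\<Sum>u\<in>?V. \<Sum>v\<in>?V. \<Sum>e\<in>?J u v. \<Sum>b\<in>?W. \<Sum>a\<in>?W. ?A a (\<pi> u e) * (h v e b * k u v a b))
       = (\<Sum>v\<in>?V. \<Sum>u\<in>?V. \<Sum>e\<in>?J v u. \<Sum>i\<in>{1..d2}. \<Sum>b\<in>?W.
            h v e b * K (y (v, b)) (x (u, \<kappa> (\<pi> u e) i))) / real d2" for h
    proof -
      have inner: "(\<Sum>b\<in>?W. \<Sum>a\<in>?W. ?A a (\<pi> u e) * (h v e b * k u v a b))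
          = (\<Sum>i\<in>{1..d2}. \<Sum>b\<in>?W. h v e b * K (y (v, b)) (x (u, \<kappa> (\<pi> u e) i))) / real d2"
        if uve: "u \<in> ?V" "v \<in> ?V" "e \<in> ?J u v" for u v e
      proof -
        have "(\<Sum>b\<in>?W. \<Sum>a\<in>?W. ?A a (\<pi> u e) * (h v e b * k u v a b))
            = (\<Sum>b\<in>?W. (\<Sum>i\<in>{1..d2}. h v e b * k u v (\<kappa> (\<pi> u e) i) b) / real d2)"
          by (intro sum.cong refl sum_neighbours[OF G2 lab] \<pi>[OF uve(3,1)])
        also have "\<dots> = (\<Sum>i\<in>{1..d2}. \<Sum>b\<in>?W. h v e b * k u v (\<kappa> (\<pi> u e) i) b) / real d2"
          unfolding sum_divide_distrib[symmetric] by (subst sum.swap) (rule refl)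
        also have "(\<Sum>i\<in>{1..d2}. \<Sum>b\<in>?W. h v e b * k u v (\<kappa> (\<pi> u e) i) b)
            = (\<Sum>i\<in>{1..d2}. \<Sum>b\<in>?W. h v e b * K (y (v, b)) (x (u, \<kappa> (\<pi> u e) i)))"
          using uve by (intro sum.cong refl arg_cong2[where f = "(*)"] k_sym \<kappa> \<pi>) auto
        finally show ?thesis .
      qed
      have "(\<Sum>u\<in>?V. \<Sum>v\<in>?V. \<Sum>e\<in>?J u v. \<Sum>b\<in>?W. \<Sum>a\<in>?W. ?A a (\<pi> u e) * (h v e b * k u v a b))
          = (\<Sum>u\<in>?V. \<Sum>v\<in>?V. \<Sum>e\<in>?J v u. (\<Sum>i\<in>{1..d2}. \<Sum>b\<in>?W.
               h v e b * K (y (v, b)) (x (u, \<kappa> (\<pi> u e) i))) / real d2)"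
        by (intro sum.cong refl inner joining_commute) (auto simp: joining_commute)
      then show ?thesis
        unfolding sum_divide_distrib[symmetric] by (subst (asm) sum.swap)
    qed
    have "S1 = (\<Sum>v\<in>?V. \<Sum>u\<in>?V. \<Sum>e\<in>?J v u. \<Sum>i\<in>{1..d2}. \<Sum>b\<in>?W.
        K (y (v, b)) (x (u, \<kappa> (\<pi> u e) i))) / real d2"
      using by_labels[of "\<lambda>_ _ _. 1"] by (simp add: S1_def)
    also have "\<dots> \<le> (\<Sum>v\<in>?V. g2 * real d1 * (\<Sum>u\<in>?V. \<Sum>e\<in>?J v u. \<Sum>i\<in>{1..d2}. \<Sum>b\<in>?W.
        ?A b (\<pi> v e) * K (y (v, b)) (x (u, \<kappa> (\<pi> u e) i)))) / real d2"
    proof (intro divide_right_mono sum_mono)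
      fix v assume v: "v \<in> ?V"
      show "(\<Sum>u\<in>?V. \<Sum>e\<in>?J v u. \<Sum>i\<in>{1..d2}. \<Sum>b\<in>?W. K (y (v, b)) (x (u, \<kappa> (\<pi> u e) i)))
        \<le> g2 * real d1 * (\<Sum>u\<in>?V. \<Sum>e\<in>?J v u. \<Sum>i\<in>{1..d2}. \<Sum>b\<in>?W.
             ?A b (\<pi> v e) * K (y (v, b)) (x (u, \<kappa> (\<pi> u e) i)))"
        unfolding d1[symmetric]
      proof (rule poincare_at_vertex[OF G1 lab v P2])
        show "y (v, b) \<in> X" if "b \<in> ?W" for b using y v that by auto
        show "x (u, \<kappa> (\<pi> u e) i) \<in> X" if "u \<in> ?V" "e \<in> ?J v u" "i \<in> {1..d2}" for u e i
          using x that \<kappa>[OF \<pi>[of e u v]] by (auto simp: joining_commute[of G1 v])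
      qed
    qed simp
    also have "\<dots> = g2 * real d1 * S2"
      using by_labels[of "\<lambda>v e b. ?A b (\<pi> v e)"]
      by (simp add: S2_def sum_distrib_left[symmetric] mult.assoc)
    finally have zig2: "S1 \<le> g2 * real d1 * S2" .
    have S2: "S2 = (\<Sum>p\<in>?V \<times> ?W. \<Sum>q\<in>?V \<times> ?W. ?Z p q * K (x p) (y q))"
    proof -
      have "(\<Sum>p\<in>?V \<times> ?W. \<Sum>q\<in>?V \<times> ?W. ?Z p q * K (x p) (y q))
          = (\<Sum>u\<in>?V. \<Sum>a\<in>?W. \<Sum>v\<in>?V. \<Sum>b\<in>?W. ?Z (u, a) (v, b) * k u v a b)"
        by (simp add: sum.cartesian_product' k_def)
      also have "\<dots> = (\<Sum>u\<in>?V. \<Sum>a\<in>?W. \<Sum>v\<in>?V. \<Sum>b\<in>?W. \<Sum>e\<in>?J u v.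
          ?A a (\<pi> u e) * ?A b (\<pi> v e) * k u v a b)"
        by (intro sum.cong refl) (simp add: normalized_adjacency_zigzag[OF G1 G2 lab] sum_distrib_right)
      also have "\<dots> = S2"
        unfolding S2_def by (simp only: pull_out_W) (rule sum.swap)
      finally show ?thesis by simp
    qed
    have "g1 * real n1 / real d1 * S0 \<le> g1 * real n1 / real d1 * (g2 * real d1 * (g2 * real d1 * S2))"
      using g by (intro mult_left_mono order_trans[OF zig1] zig2) auto
    \<comment> \<open>The \<open>1 / d1\<close> from the adjacency matrix of \<open>G1\<close> cancels the \<open>d1 = card ?W\<close> of one zig; the
      other one turns \<open>n1\<close> into the number of vertices of the product.\<close>
    also have "\<dots> = g1 * g2\<^sup>2 * real (card (?V \<times> ?W)) * S2"
      by (simp add: card_cartesian_product d1 n1_def power2_eq_square)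
    finally show ?thesis
      using zag unfolding S2 by linarith
  qed
  then show ?thesis using g by (simp add: poincare_def)
qed

theorem theorem1:
  fixes G1 :: "('v, 'e) mgraph" and G2 :: "('w, 'f) mgraph"
    and n1 d1 d2 :: nat
    and \<pi> :: "'v \<Rightarrow> 'e \<Rightarrow> 'w" and \<kappa> :: "'w \<Rightarrow> nat \<Rightarrow> 'w"
    and X :: "'x set" and K :: "'x \<Rightarrow> 'x \<Rightarrow> real"
  assumes "regular G1 d1" and "card (verts G1) = n1"
    and "regular G2 d2" and "card (verts G2) = d1"
    and "zigzag_labels G1 G2 d2 \<pi> \<kappa>"
    and "kernel_on X K"
  shows "graph_gamma_plus (zigzag G1 G2 d2 \<pi> \<kappa>) (d2\<^sup>2) X K
           \<le> graph_gamma_plus G1 d1 X K * (graph_gamma_plus G2 d2 X K)\<^sup>2"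
proof -
  let ?V = "verts G1" and ?W = "verts G2"
  let ?Z = "normalized_adjacency (zigzag G1 G2 d2 \<pi> \<kappa>) (d2\<^sup>2)"
  let ?\<gamma>1 = "graph_gamma_plus G1 d1 X K" and ?\<gamma>2 = "graph_gamma_plus G2 d2 X K"
  have G: "multigraph G1" "multigraph G2" using assms by (auto simp: regular_def)
  then have fin: "finite ?V" "finite ?W" by (auto simp: multigraph_def)
  have zz: "graph_gamma_plus (zigzag G1 G2 d2 \<pi> \<kappa>) (d2\<^sup>2) X K = gamma_plus (?V \<times> ?W) ?Z X K"
    by (simp add: graph_gamma_plus_def zigzag_def)
  show ?thesis
  proof (cases "?V = {} \<or> ?W = {} \<or> (\<forall>x\<in>X. \<forall>y\<in>X. K x y = 0)")
    case True
    then have "poincare (?V \<times> ?W) ?Z X K 0"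
      by (auto simp: poincare_def Pi_iff intro!: sum_nonpos)
    then show ?thesis
      using gamma_plus_le[of "?V \<times> ?W"] fin unfolding zz by fastforce
  next
    case False
    then obtain x y where ne: "?V \<noteq> {}" "?W \<noteq> {}" and xy: "x \<in> X" "y \<in> X" "K x y \<noteq> 0" by blast
    have pos: "?\<gamma>1 \<noteq> 0" "?\<gamma>2 \<noteq> 0"
      unfolding graph_gamma_plus_def
      using gamma_plus_eq_0D[where A = "normalized_adjacency G1 d1",
          OF fin(1) ne(1) normalized_adjacency_nonneg assms(6) _ xy(1,2)]
        gamma_plus_eq_0D[where A = "normalized_adjacency G2 d2",
          OF fin(2) ne(2) normalized_adjacency_nonneg assms(6) _ xy(1,2)] xy(3)
      by blast+
    show ?thesis
    proof (cases "?\<gamma>1 = \<infinity> \<or> ?\<gamma>2 = \<infinity>")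
      case True
      then have "?\<gamma>1 * ?\<gamma>2\<^sup>2 = \<infinity>"
        using pos by (auto simp: power2_eq_square ennreal_mult_top ennreal_top_mult)
      then show ?thesis by simp
    next
      case False
      then have "gamma_plus ?V (normalized_adjacency G1 d1) X K \<noteq> \<infinity>"
        "gamma_plus ?W (normalized_adjacency G2 d2) X K \<noteq> \<infinity>"
        by (simp_all add: graph_gamma_plus_def)
      with poincare_gamma_plus[where A = "normalized_adjacency G1 d1",
          OF fin(1) normalized_adjacency_nonneg assms(6)]
        poincare_gamma_plus[where A = "normalized_adjacency G2 d2",
          OF fin(2) normalized_adjacency_nonneg assms(6)]
      obtain g1 g2 where
        g1: "?\<gamma>1 = ennreal g1" "poincare ?V (normalized_adjacency G1 d1) X K g1" and
        g2: "?\<gamma>2 = ennreal g2" "poincare ?W (normalized_adjacency G2 d2) X K g2"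
        unfolding graph_gamma_plus_def by blast
      have "gamma_plus (?V \<times> ?W) ?Z X K \<le> ennreal (g1 * g2\<^sup>2)"
        using poincare_zigzag[OF G assms(4,5,6) g1(2) g2(2)] fin by (intro gamma_plus_le) auto
      also have "\<dots> = ?\<gamma>1 * ?\<gamma>2\<^sup>2"
        using g1 g2 by (simp add: poincare_def ennreal_mult ennreal_power)
      finally show ?thesis unfolding zz .
    qed
  qed
qed

end
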